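(* Let $\hat{\boldsymbol a}\in\arg\max_{\boldsymbol a\in\Omega}\Phi(\boldsymbol a)$ be the socially-aware Nash equilibrium to which the distributed spectrum access algorithm converges as $\theta\to\infty$. Let $V(\boldsymbol a)=\sum_{n=1}^N U_n(\boldsymbol a)$ and $\overline{\boldsymbol a}\in\arg\max_{\boldsymbol a\in\Omega}V(\boldsymbol a)$. Then the performance gap of $\hat{\boldsymbol a}$ satisfies $$V(\overline{\boldsymbol a})-V(\hat{\boldsymbol a})\le\frac12\sum_{n=1}^N\sum_{m\in\mathcal N_n^{sp}}(1-w_{nm})P_m d_{mn}^{-\alpha}+\frac12\sum_{n=1}^N\sum_{m\in\mathcal N_n^p\setminus\mathcal N_n^{sp}}P_m d_{mn}^{-\alpha}.$$
   Context: Users: $\mathcal N=\{1,\dots,N\}$. User $n$ chooses a channel $a_n$ from a nonempty finite set $\mathcal M_n$ of vacant channels; $\boldsymbol a\in\Omega=\prod_n\mathcal M_n$. $P_m>0$ is the transmission power of user $m$, $d_{mn}=d_{nm}>0$ is the distance between $m\ne n$, $\alpha>0$ is the path loss factor, $\omega^n_a\in\mathbb R$ is the noise power of user $n$ on channel $a$, and $I_{\{\cdot\}}$ is the indicator. Physical and social graphs on $\mathcal N$ (no loops) have neighbour sets $\mathcal N_n^p$ and $\mathcal N_n^s$; $\mathcal N_n^{sp}=\mathcal N_n^p\cap\mathcal N_n^s$; social ties have strengths $w_{nm}\in[0,1]$. Standing assumptions: equal powers ($P_n=P_m$), both graphs undirected, $w_{nm}=w_{mn}$. Individual utility: $U_n(\boldsymbol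 a)=-\sum_{m\in\mathcal N_n^p}P_m d_{mn}^{-\alpha}I_{\{a_n=a_m\}}-\omega^n_{a_n}$. Potential function: $$\Phi(\boldsymbol a)=-\frac12\sum_{n}\sum_{m\in\mathcal N_n^p}P_m d_{mn}^{-\alpha}I_{\{a_n=a_m\}}-\sum_n\omega^n_{a_n}-\frac12\sum_n\sum_{m\in\mathcal N_n^{sp}}w_{nm}P_m d_{mn}^{-\alpha}I_{\{a_n=a_m\}}.$$ The algorithm enters the statement only through $\hat{\boldsymbol a}$, defined as a maximizer of $\Phi$. *)

theory Defs
  imports Complex_Main "HOL-Library.FuncSet"
begin

definition profiles :: "nat \<Rightarrow> (nat \<Rightarrow> 'c set) \<Rightarrow> (nat \<Rightarrow> 'c) set" where
  "profiles N M = (\<Pi>\<^sub>E n\<in>{1..N}. M n)"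

definition simple_graph :: "nat \<Rightarrow> nat rel \<Rightarrow> bool" where
  "simple_graph N E \<longleftrightarrow> E \<subseteq> {1..N} \<times> {1..N} \<and> irrefl E \<and> sym E"

definition nbrs :: "nat rel \<Rightarrow> nat \<Rightarrow> nat set" where
  "nbrs E n = E `` {n}"

text \<open>
  Below, \<open>P\<close> is the vector of transmission powers, \<open>d\<close> the distance matrix, \<open>\<alpha>\<close> the path loss
  factor, \<open>\<omega> n c\<close> the noise power of user \<open>n\<close> on channel \<open>c\<close>, and \<open>w\<close> the matrix of social tie
  strengths; \<open>Ep\<close> and \<open>Es\<close> are the edge sets of the physical and the social graph.
\<close>

definition utility ::
  "(nat \<Rightarrow> real) \<Rightarrow> (nat \<Rightarrow> nat \<Rightarrow> real) \<Rightarrow> real \<Rightarrow> (nat \<Rightarrow> 'c \<Rightarrow> real) \<Rightarrow> nat rel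
    \<Rightarrow> nat \<Rightarrow> (nat \<Rightarrow> 'c) \<Rightarrow> real" where
  "utility P d \<alpha> \<omega> Ep n a =
     - (\<Sum>m\<in>nbrs Ep n. P m * d m n powr (- \<alpha>) * of_bool (a n = a m)) - \<omega> n (a n)"

definition welfare ::
  "nat \<Rightarrow> (nat \<Rightarrow> real) \<Rightarrow> (nat \<Rightarrow> nat \<Rightarrow> real) \<Rightarrow> real \<Rightarrow> (nat \<Rightarrow> 'c \<Rightarrow> real) \<Rightarrow> nat rel
    \<Rightarrow> (nat \<Rightarrow> 'c) \<Rightarrow> real" where
  "welfare N P d \<alpha> \<omega> Ep a = (\<Sum>n=1..N. utility P d \<alpha> \<omega> Ep n a)"

definition potential ::
  "nat \<Rightarrow> (nat \<Rightarrow> real) \<Rightarrow> (nat \<Rightarrow> nat \<Rightarrow> real) \<Rightarrow> real \<Rightarrow> (nat \<Rightarrow> 'c \<Rightarrow> real) \<Rightarrow> nat rel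
    \<Rightarrow> nat rel \<Rightarrow> (nat \<Rightarrow> nat \<Rightarrow> real) \<Rightarrow> (nat \<Rightarrow> 'c) \<Rightarrow> real" where
  "potential N P d \<alpha> \<omega> Ep Es w a =
     - (1/2) * (\<Sum>n=1..N. \<Sum>m\<in>nbrs Ep n.
         P m * d m n powr (- \<alpha>) * of_bool (a n = a m))
     - (\<Sum>n=1..N. \<omega> n (a n))
     - (1/2) * (\<Sum>n=1..N. \<Sum>m\<in>nbrs Ep n \<inter> nbrs Es n.
         w n m * P m * d m n powr (- \<alpha>) * of_bool (a n = a m))"

end

theory Submission
  imports Defs
begin

text \<open>
  The difference \<open>\<Phi> - V\<close> collects the interference that the social coupling does not internalise.
  It lies between \<open>0\<close> and its value when every pair of neighbours collides, which is the right-hand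
  side \<open>B\<close> of the bound.  Hence, writing \<open>a\<close> for the maximiser of \<open>\<Phi>\<close> and \<open>b\<close> for that of \<open>V\<close>,
  \<open>V b \<le> \<Phi> b \<le> \<Phi> a \<le> V a + B\<close>.
\<close>

lemma nbrs_subset:
  assumes "simple_graph N E"
  shows "nbrs E n \<subseteq> {1..N}"
  using assms unfolding simple_graph_def nbrs_def by blast

text \<open>The noise terms cancel. A colliding pair \<open>(n, m)\<close> costs its interference
  once in the welfare; in the potential it costs half of it, plus a further \<open>w n m / 2\<close>
  of it if \<open>m\<close> is also a social neighbour. Splitting the physical neighbours into
  social and non-social ones leaves the weights \<open>(1 - w n m) / 2\<close> and
  \<open>1 / 2\<close>.\<close>

lemma potential_minus_welfare:
  assumes "simple_graph N Ep"
  shows "potential N P d \<alpha> \<omega> Ep Es w a - welfare N P d \<alpha> \<omega> Ep a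
    = 1/2 * (\<Sum>n=1..N. \<Sum>m\<in>nbrs Ep n \<inter> nbrs Es n.
        (1 - w n m) * P m * d m n powr (- \<alpha>) * of_bool (a n = a m))
      + 1/2 * (\<Sum>n=1..N. \<Sum>m\<in>nbrs Ep n - (nbrs Ep n \<inter> nbrs Es n).
        P m * d m n powr (- \<alpha>) * of_bool (a n = a m))"
proof -
  \<comment> \<open>The product is bracketed to the right so that, after rewriting with
    \<open>mult.assoc\<close>, each summand is \<open>f n m\<close> alone or with one factor in
    front; the claim is then linear in a few double sums.\<close>
  define f where "f n m = P m * (d m n powr (- \<alpha>) * of_bool (a n = a m))" for n m
  have "finite (nbrs Ep n)" for n
    using nbrs_subset[OF assms] by (rule finite_subset) simp
  then have "(\<Sum>m\<in>nbrs Ep n. f n m)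
      = (\<Sum>m\<in>nbrs Ep n - (nbrs Ep n \<inter> nbrs Es n). f n m) + (\<Sum>m\<in>nbrs Ep n \<inter> nbrs Es n. f n m)" for n
    by (intro sum.subset_diff) auto
  then have "(\<Sum>n=1..N. \<Sum>m\<in>nbrs Ep n. f n m)
      = (\<Sum>n=1..N. \<Sum>m\<in>nbrs Ep n - (nbrs Ep n \<inter> nbrs Es n). f n m)
        + (\<Sum>n=1..N. \<Sum>m\<in>nbrs Ep n \<inter> nbrs Es n. f n m)"
    by (simp add: sum.distrib)
  moreover have "(\<Sum>n=1..N. \<Sum>m\<in>nbrs Ep n \<inter> nbrs Es n. (1 - w n m) * f n m)
      = (\<Sum>n=1..N. \<Sum>m\<in>nbrs Ep n \<inter> nbrs Es n. f n m)
        - (\<Sum>n=1..N. \<Sum>m\<in>nbrs Ep n \<inter> nbrs Es n. w n m * f n m)"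
    by (simp add: left_diff_distrib sum_subtractf)
  moreover have "potential N P d \<alpha> \<omega> Ep Es w a = - (1/2) * (\<Sum>n=1..N. \<Sum>m\<in>nbrs Ep n. f n m)
      - (\<Sum>n=1..N. \<omega> n (a n)) - (1/2) * (\<Sum>n=1..N. \<Sum>m\<in>nbrs Ep n \<inter> nbrs Es n. w n m * f n m)"
    by (simp add: potential_def f_def mult.assoc)
  moreover have "welfare N P d \<alpha> \<omega> Ep a
      = - (\<Sum>n=1..N. \<Sum>m\<in>nbrs Ep n. f n m) - (\<Sum>n=1..N. \<omega> n (a n))"
    by (simp add: welfare_def utility_def f_def mult.assoc sum_subtractf sum_negf)
  ultimately show ?thesis
    unfolding mult.assoc unfolding f_def[symmetric] by linarith
qed

theorem corollary1:
  fixes N :: nat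
    and M :: "nat \<Rightarrow> 'c set"
    and P :: "nat \<Rightarrow> real"
    and d :: "nat \<Rightarrow> nat \<Rightarrow> real"
    and \<alpha> :: real
    and \<omega> :: "nat \<Rightarrow> 'c \<Rightarrow> real"
    and Ep Es :: "nat rel"
    and w :: "nat \<Rightarrow> nat \<Rightarrow> real"
    and a_hat a_bar :: "nat \<Rightarrow> 'c"
  assumes channels: "\<And>n. n \<in> {1..N} \<Longrightarrow> finite (M n) \<and> M n \<noteq> {}"
    and power_pos: "\<And>n. n \<in> {1..N} \<Longrightarrow> P n > 0"
    and power_equal: "\<And>n m. n \<in> {1..N} \<Longrightarrow> m \<in> {1..N} \<Longrightarrow> P n = P m"
    and dist: "\<And>n m. n \<in> {1..N} \<Longrightarrow> m \<in> {1..N} \<Longrightarrow> m \<noteq> n \<Longrightarrow> d m n = d n m \<and> d m n > 0"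
    and path_loss: "\<alpha> > 0"
    and physical: "simple_graph N Ep"
    and social: "simple_graph N Es"
    and ties: "\<And>n m. n \<in> {1..N} \<Longrightarrow> m \<in> nbrs Es n \<Longrightarrow> w n m \<in> {0..1} \<and> w n m = w m n"
    and a_hat: "is_arg_max (potential N P d \<alpha> \<omega> Ep Es w) (\<lambda>a. a \<in> profiles N M) a_hat"
    and a_bar: "is_arg_max (welfare N P d \<alpha> \<omega> Ep) (\<lambda>a. a \<in> profiles N M) a_bar"
  shows "welfare N P d \<alpha> \<omega> Ep a_bar - welfare N P d \<alpha> \<omega> Ep a_hat
    \<le> 1/2 * (\<Sum>n=1..N. \<Sum>m\<in>nbrs Ep n \<inter> nbrs Es n. (1 - w n m) * P m * d m n powr (- \<alpha>))
      + 1/2 * (\<Sum>n=1..N. \<Sum>m\<in>nbrs Ep n - (nbrs Ep n \<inter> nbrs Es n). P m * d m n powr (- \<alpha>))"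
proof -
  let ?\<Phi> = "potential N P d \<alpha> \<omega> Ep Es w" and ?V = "welfare N P d \<alpha> \<omega> Ep"
  have P: "P m \<ge> 0" if "m \<in> nbrs Ep n" for n m
    using that nbrs_subset[OF physical] power_pos by (meson less_imp_le subsetD)
  have w: "w n m \<le> 1" if "n \<in> {1..N}" "m \<in> nbrs Es n" for n m
    using ties[OF that] by simp
  have "?V a_bar \<le> ?\<Phi> a_bar"
  proof -
    have "0 \<le> ?\<Phi> a_bar - ?V a_bar"
      unfolding potential_minus_welfare[OF physical]
      by (intro add_nonneg_nonneg mult_nonneg_nonneg sum_nonneg) (auto simp: P w)
    then show ?thesis by simp
  qed
  \<comment> \<open>\<open>a_bar\<close> is a profile, hence a competitor of the maximizer
    \<open>a_hat\<close>.\<close>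
  also have "?\<Phi> a_bar \<le> ?\<Phi> a_hat"
    using a_hat a_bar by (auto simp: is_arg_max_linorder)
  finally have "?V a_bar - ?V a_hat \<le> ?\<Phi> a_hat - ?V a_hat"
    by simp
  \<comment> \<open>Termwise, \<open>of_bool\<close> is at most 1 and its cofactor is nonnegative,
    so dropping it, as if all neighbours collided, can only increase the sums.\<close>
  also have "\<dots> \<le> 1/2 * (\<Sum>n=1..N. \<Sum>m\<in>nbrs Ep n \<inter> nbrs Es n. (1 - w n m) * P m * d m n powr (- \<alpha>))
      + 1/2 * (\<Sum>n=1..N. \<Sum>m\<in>nbrs Ep n - (nbrs Ep n \<inter> nbrs Es n). P m * d m n powr (- \<alpha>))"
    unfolding potential_minus_welfare[OF physical]
    by (intro add_mono mult_left_mono sum_mono mult_right_le_one_le mult_nonneg_nonneg) (auto simp: P w)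
  finally show ?thesis .
qed

end
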